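(* Let $(c_n)_{n\ge0}$ be a sequence of nonzero numbers with $c_0=1$, let $\omega$ be an umbra with $\omega^n\simeq n!/c_n$ for all $n\ge0$, and let $\gamma,\alpha,\lambda$ be umbrae. For any integers $m,n,k$ with $n\ge k\ge 0$, \[ {}_{\omega}(\gamma,\alpha)_{n,k}\simeq\frac{c_n}{c_k}\sum_{i=0}^{n-k}\frac{\big(m.\mathfrak K_{\alpha,\lambda}\big)^{i}}{i!}\,\frac{\big(\gamma+(k-m).\alpha+i.\lambda\big)^{n-k-i}}{(n-k-i)!}. \] Equivalently, \[ {}_{\omega}(\gamma,\alpha)_{n,k}\simeq\frac{c_n}{c_k\,c_{n-k}}\sum_{i=0}^{n-k}c_i\,\frac{\big(m.\mathfrak K_{\alpha,\lambda}\big)^{i}}{i!}\;{}_{\omega}\big(\gamma+(k-m).\alpha,\lambda\big)_{n-k,i}. \]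
   Context: Classical umbral calculus: $R=\mathbb{C}[x]$, $A$ a saturated alphabet of umbrae, $E:R[A]\to R$ linear with $E[1]=1$ and $E[\alpha^i\beta^j\cdots]=E[\alpha^i]E[\beta^j]\cdots$ for distinct umbrae; $p\simeq q$ means $E[p]=E[q]$, $p\equiv q$ means $p^n\simeq q^n$ for all $n$. $f_\alpha(t)=\sum_n E[\alpha^n]t^n/n!$. For $x\in R\cup A$ (e.g. any integer) $x.\alpha$ is the umbra (up to similarity) with $(x.\alpha)^n\simeq n![t^n]f_\alpha(t)^x$. For umbrae $\sigma,\alpha$, $\mathfrak K_{\sigma,\alpha}$ is an umbra with $\mathfrak K_{\sigma,\alpha}^0=1$ and $\mathfrak K_{\sigma,\alpha}^n\simeq\sigma(\sigma+(-n).\alpha)^{n-1}$ for $n\ge1$ (here $(-n).\alpha$ is uncorrelated with $\sigma$); $m.\mathfrak K_{\alpha,\lambda}$ is the dot product just defined. For umbral polynomials $p,q$ (e.g. $p=\gamma+(k-m).\alpha$), the $\omega$-Riordan array ${}_\omega(p,q)$ is the infinite lower triangular matrix with entries ${}_\omega(p,q)_{n,k}=E\!\left[\frac{c_n}{c_k}\frac{(p+k.q)^{n-k}}{(n-k)!}\right]\in R$ for $n\ge k\ge0$. Convention: distinct auxiliary umbrae in a formula (such as $m.\mathfrak K_{\alpha,\lambda}$, $\gamma$, $(k-m).\alpha$, $i.\lambda$) are represented by mutually uncorrelated umbrae. *)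

theory Defs
  imports
    "HOL-Library.Poly_Mapping"
    "HOL-Computational_Algebra.Computational_Algebra"
    Complex_Main
begin

text \<open>
  The base ring \<open>R\<close> is \<open>\<complex>[x]\<close>, i.e. the type \<open>complex poly\<close>.  The elements of the type \<open>'u\<close>
  are the umbrae of the alphabet \<open>A\<close>, and \<open>R[A]\<close> is the ring of finitely supported maps from
  monomials \<open>'u \<Rightarrow>\<^sub>0 nat\<close> (exponent vectors) to \<open>R\<close>, with the convolution product.
\<close>

type_synonym 'u umbral_poly = "('u \<Rightarrow>\<^sub>0 nat) \<Rightarrow>\<^sub>0 complex poly"

definition umbra :: "'u \<Rightarrow> 'u umbral_poly" where
  "umbra \<alpha> = Poly_Mapping.single (Poly_Mapping.single \<alpha> 1) 1"

definition base :: "complex poly \<Rightarrow> 'u umbral_poly" where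
  "base r = Poly_Mapping.single 0 r"

abbreviation scalar :: "complex \<Rightarrow> 'u umbral_poly" where
  "scalar a \<equiv> base [:a:]"

definition umbrae_of :: "'u umbral_poly \<Rightarrow> 'u set" where
  "umbrae_of p = (\<Union>m\<in>Poly_Mapping.keys p. Poly_Mapping.keys m)"

text \<open>
  Saturation: every sequence in \<open>R\<close> starting with \<open>1\<close> is the moment sequence of infinitely many
  umbrae, so that every auxiliary umbra has a representative in the alphabet that is
  uncorrelated with (distinct from) any finitely many given umbrae.
\<close>

locale umbral_calculus =
  fixes E :: "'u umbral_poly \<Rightarrow> complex poly"
  assumes E_add: "E (p + q) = E p + E q"
    and E_base_mult: "E (base r * p) = r * E p"
    and E_one: "E 1 = 1"
    and E_uncorrelated: "finite S \<Longrightarrow> E (\<Prod>\<alpha>\<in>S. umbra \<alpha> ^ e \<alpha>) = (\<Prod>\<alpha>\<in>S. E (umbra \<alpha> ^ e \<alpha>))"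
    and saturated: "a 0 = 1 \<Longrightarrow> infinite {\<alpha>. \<forall>n. E (umbra \<alpha> ^ n) = a n}"

definition umbral_eq ::
    "('u umbral_poly \<Rightarrow> complex poly) \<Rightarrow> 'u umbral_poly \<Rightarrow> 'u umbral_poly \<Rightarrow> bool" where
  "umbral_eq E p q \<longleftrightarrow> E p = E q"

definition umbral_gf ::
    "('u umbral_poly \<Rightarrow> complex poly) \<Rightarrow> 'u umbral_poly \<Rightarrow> complex poly fps" where
  "umbral_gf E p = Abs_fps (\<lambda>n. smult (1 / fact n) (E (p ^ n)))"

text \<open>
  Integer powers of a power series with constant term \<open>1\<close>.  The coefficient ring is not a
  field, hence the reciprocal is taken with the ring version of the inverse.
\<close>

definition fps_int_power :: "'a::comm_ring_1 fps \<Rightarrow> int \<Rightarrow> 'a fps" where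
  "fps_int_power f m =
     (if 0 \<le> m then f ^ nat m else fps_right_inverse f 1 ^ nat (- m))"

lemma fps_int_power_minus:
  assumes "fps_nth f 0 = 1"
  shows "fps_int_power f m * fps_int_power f (- m) = 1"
proof -
  have "f * fps_right_inverse f 1 = 1"
    using assms by (intro fps_right_inverse) simp
  then show ?thesis
    by (cases "m = 0")
      (auto simp: fps_int_power_def mult.commute simp flip: power_mult_distrib)
qed

text \<open>
  The auxiliary umbra \<open>m.p\<close> is only determined up to similarity: \<open>is_dot E m p \<beta>\<close> says
  that the umbra \<open>\<beta>\<close> represents it.
\<close>

definition is_dot ::
    "('u umbral_poly \<Rightarrow> complex poly) \<Rightarrow> int \<Rightarrow> 'u umbral_poly \<Rightarrow> 'u \<Rightarrow> bool" where
  "is_dot E m p \<beta> \<longleftrightarrow>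
     (\<forall>n. E (umbra \<beta> ^ n) = smult (fact n) (fps_nth (fps_int_power (umbral_gf E p) m) n))"

text \<open>
  A representative of \<open>m.p\<close> not occurring in \<open>S\<close>; it is used only under \<open>E\<close>, next to
  umbral polynomials over \<open>S\<close>, where the choice is immaterial.
\<close>

definition dot_avoiding ::
    "('u umbral_poly \<Rightarrow> complex poly) \<Rightarrow> 'u set \<Rightarrow> int \<Rightarrow> 'u umbral_poly \<Rightarrow> 'u" where
  "dot_avoiding E S m p = (SOME \<beta>. \<beta> \<notin> S \<and> is_dot E m p \<beta>)"

text \<open>
  \<open>is_K E \<sigma> \<alpha> \<kappa>\<close> says that \<open>\<kappa>\<close> represents the umbra \<open>\<KK>\<^bsub>\<sigma>,\<alpha>\<^esub>\<close>; the condition at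
  \<open>n = 0\<close> is the identity \<open>\<kappa>\<^sup>0 = 1\<close>.
\<close>

definition is_K ::
    "('u umbral_poly \<Rightarrow> complex poly) \<Rightarrow> 'u \<Rightarrow> 'u \<Rightarrow> 'u \<Rightarrow> bool" where
  "is_K E \<sigma> \<alpha> \<kappa> \<longleftrightarrow>
     (\<forall>n\<ge>1. umbral_eq E (umbra \<kappa> ^ n)
        (umbra \<sigma> *
          (umbra \<sigma> + umbra (dot_avoiding E {\<sigma>} (- int n) (umbra \<alpha>))) ^ (n - 1)))"

definition omega_riordan ::
    "('u umbral_poly \<Rightarrow> complex poly) \<Rightarrow> (nat \<Rightarrow> complex) \<Rightarrow>
      'u umbral_poly \<Rightarrow> 'u umbral_poly \<Rightarrow> nat \<Rightarrow> nat \<Rightarrow> complex poly" where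
  "omega_riordan E c p q n k =
     (if k \<le> n
      then E (scalar (c n / c k) * (scalar (1 / fact (n - k)) *
             (p + umbra (dot_avoiding E (umbrae_of p) (int k) q)) ^ (n - k)))
      else 0)"

context umbral_calculus
begin

lemma umbral_gf_nth_0: "fps_nth (umbral_gf E p) 0 = 1"
  by (simp add: umbral_gf_def E_one)

lemma fps_int_power_gf_nth_0: "fps_nth (fps_int_power (umbral_gf E p) m) 0 = 1"
  by (simp add: fps_int_power_def umbral_gf_nth_0 fps_power_zeroth)

lemma ex_umbra_avoiding:
  assumes "finite S" "a 0 = 1"
  obtains \<beta> where "\<beta> \<notin> S" "\<And>n. E (umbra \<beta> ^ n) = a n"
proof -
  have "infinite ({\<beta>. \<forall>n. E (umbra \<beta> ^ n) = a n} - S)"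
    using saturated[of a] assms by (intro Diff_infinite_finite) auto
  then obtain \<beta> where "\<beta> \<in> {\<beta>. \<forall>n. E (umbra \<beta> ^ n) = a n} - S"
    using infinite_imp_nonempty by blast
  then show thesis by (intro that) auto
qed

lemma dot_avoiding:
  assumes "finite S"
  shows "dot_avoiding E S m p \<notin> S" "is_dot E m p (dot_avoiding E S m p)"
proof -
  let ?a = "\<lambda>n. smult (fact n) (fps_nth (fps_int_power (umbral_gf E p) m) n)"
  obtain \<beta> where "\<beta> \<notin> S" "\<And>n. E (umbra \<beta> ^ n) = ?a n"
    by (rule ex_umbra_avoiding[of S ?a]) (use assms fps_int_power_gf_nth_0 in auto)
  then have "\<exists>\<beta>. \<beta> \<notin> S \<and> is_dot E m p \<beta>"
    by (auto simp: is_dot_def)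
  then have "dot_avoiding E S m p \<notin> S \<and> is_dot E m p (dot_avoiding E S m p)"
    unfolding dot_avoiding_def by (rule someI_ex)
  then show "dot_avoiding E S m p \<notin> S" "is_dot E m p (dot_avoiding E S m p)"
    by auto
qed

lemma ex_is_K_avoiding:
  assumes "finite S"
  shows "\<exists>\<kappa>. \<kappa> \<notin> S \<and> is_K E \<sigma> \<alpha> \<kappa>"
proof -
  let ?a = "\<lambda>n. if n = 0 then 1 else E (umbra \<sigma> *
          (umbra \<sigma> + umbra (dot_avoiding E {\<sigma>} (- int n) (umbra \<alpha>))) ^ (n - 1))"
  obtain \<beta> where "\<beta> \<notin> S" "\<And>n. E (umbra \<beta> ^ n) = ?a n"
    by (rule ex_umbra_avoiding[of S ?a]) (use assms in auto)
  then show ?thesis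
    by (intro exI[of _ \<beta>]) (auto simp: is_K_def umbral_eq_def)
qed

end

lemma umbra_power: "umbra \<alpha> ^ n = Poly_Mapping.single (Poly_Mapping.single \<alpha> n) 1"
  by (induction n) (simp_all add: umbra_def mult_single flip: single_add)

lemma prod_umbra_power:
  assumes "finite S"
  shows "(\<Prod>\<alpha>\<in>S. umbra \<alpha> ^ e \<alpha>) =
    Poly_Mapping.single (\<Sum>\<alpha>\<in>S. Poly_Mapping.single \<alpha> (e \<alpha>)) 1"
  using assms by induction (simp_all add: umbra_power mult_single)

definition moment_eval ::
    "('u \<Rightarrow> nat \<Rightarrow> complex poly) \<Rightarrow> 'u umbral_poly \<Rightarrow> complex poly" where
  "moment_eval a p = (\<Sum>m\<in>Poly_Mapping.keys p.
     Poly_Mapping.lookup p m *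
       (\<Prod>\<alpha>\<in>Poly_Mapping.keys m. a \<alpha> (Poly_Mapping.lookup m \<alpha>)))"

lemma moment_eval_superset:
  assumes "finite K" "Poly_Mapping.keys p \<subseteq> K"
  shows "moment_eval a p = (\<Sum>m\<in>K. Poly_Mapping.lookup p m *
       (\<Prod>\<alpha>\<in>Poly_Mapping.keys m. a \<alpha> (Poly_Mapping.lookup m \<alpha>)))"
  unfolding moment_eval_def using assms
  by (intro sum.mono_neutral_left) (auto simp: in_keys_iff)

lemma moment_eval_single:
  "moment_eval a (Poly_Mapping.single m r) =
     r * (\<Prod>\<alpha>\<in>Poly_Mapping.keys m. a \<alpha> (Poly_Mapping.lookup m \<alpha>))"
  by (subst moment_eval_superset[of "{m}"]) auto

lemma lookup_base_mult:
  "Poly_Mapping.lookup (base r * p) m = r * Poly_Mapping.lookup p m"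
  unfolding base_def mult_map_scale_conv_mult[symmetric]
  by (simp add: Poly_Mapping.map.rep_eq when_def)

lemma moment_eval_prod_umbra:
  assumes "finite S" and a0: "\<And>\<alpha>. a \<alpha> 0 = 1"
  shows "moment_eval a (\<Prod>\<alpha>\<in>S. umbra \<alpha> ^ e \<alpha>) = (\<Prod>\<alpha>\<in>S. a \<alpha> (e \<alpha>))"
proof -
  let ?m = "\<Sum>\<alpha>\<in>S. Poly_Mapping.single \<alpha> (e \<alpha>)"
  have lk: "Poly_Mapping.lookup ?m \<beta> = (if \<beta> \<in> S then e \<beta> else 0)" for \<beta>
    using assms(1) by (simp add: lookup_sum lookup_single when_def)
  have "(\<Prod>\<alpha>\<in>Poly_Mapping.keys ?m. a \<alpha> (Poly_Mapping.lookup ?m \<alpha>)) =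
      (\<Prod>\<alpha>\<in>S. a \<alpha> (Poly_Mapping.lookup ?m \<alpha>))"
    using assms by (intro prod.mono_neutral_left) (auto simp: in_keys_iff lk split: if_splits)
  then show ?thesis
    using assms by (simp add: prod_umbra_power moment_eval_single lk)
qed

lemma ex_umbral_calculus:
  "\<exists>E :: ((nat \<Rightarrow> complex poly) \<times> nat) umbral_poly \<Rightarrow> complex poly. umbral_calculus E"
proof -
  define a :: "(nat \<Rightarrow> complex poly) \<times> nat \<Rightarrow> nat \<Rightarrow> complex poly"
    where "a = (\<lambda>u n. if n = 0 then 1 else fst u n)"
  have a0: "a \<alpha> 0 = 1" for \<alpha> by (simp add: a_def)
  have pow: "moment_eval a (umbra \<alpha> ^ n) = a \<alpha> n" for \<alpha> n
    using moment_eval_prod_umbra[of "{\<alpha>}" a "\<lambda>_. n"] a0 by simp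
  have "umbral_calculus (moment_eval a)"
  proof
    fix p q :: "((nat \<Rightarrow> complex poly) \<times> nat) umbral_poly"
    let ?K = "Poly_Mapping.keys p \<union> Poly_Mapping.keys q"
    show "moment_eval a (p + q) = moment_eval a p + moment_eval a q"
      using keys_add[of p q]
      by (simp add: moment_eval_superset[of ?K] lookup_add algebra_simps sum.distrib)
  next
    fix r and p :: "((nat \<Rightarrow> complex poly) \<times> nat) umbral_poly"
    have "Poly_Mapping.keys (base r * p) \<subseteq> Poly_Mapping.keys p"
      by (auto simp: in_keys_iff lookup_base_mult)
    then show "moment_eval a (base r * p) = r * moment_eval a p"
      by (simp add: moment_eval_superset[of "Poly_Mapping.keys p"] lookup_base_mult
          sum_distrib_left mult.assoc)
  next
    show "moment_eval a 1 = 1"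
      using moment_eval_prod_umbra[of "{}" a] a0 by simp
  next
    fix S :: "((nat \<Rightarrow> complex poly) \<times> nat) set" and e
    assume "finite S"
    then show "moment_eval a (\<Prod>\<alpha>\<in>S. umbra \<alpha> ^ e \<alpha>) =
        (\<Prod>\<alpha>\<in>S. moment_eval a (umbra \<alpha> ^ e \<alpha>))"
      by (simp add: moment_eval_prod_umbra a0 pow)
  next
    fix b :: "nat \<Rightarrow> complex poly"
    assume b: "b 0 = 1"
    have "range (Pair b) \<subseteq> {\<alpha>. \<forall>n. moment_eval a (umbra \<alpha> ^ n) = b n}"
      unfolding pow using b by (auto simp: a_def)
    moreover have "infinite (range (Pair b :: nat \<Rightarrow> _))"
      by (rule range_inj_infinite) (simp add: inj_on_def)
    ultimately show "infinite {\<alpha>. \<forall>n. moment_eval a (umbra \<alpha> ^ n) = b n}"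
      using finite_subset by blast
  qed
  then show ?thesis by blast
qed

end

theory Submission
  imports Defs
begin

text \<open>
  Write \<open>f\<close>, \<open>g\<close>, \<open>l\<close> for the generating functions of \<open>\<alpha>\<close>, \<open>\<gamma>\<close>, \<open>\<lambda>\<close>. The moments of
  \<open>\<KK>\<^bsub>\<alpha>,\<lambda>\<^esub>\<close> say that its generating function \<open>h\<close> has coefficients
  \<open>[t\<^sup>n] h = 1/n [t\<^sup>n\<^sup>-\<^sup>1] f' l\<^sup>-\<^sup>n\<close>, so \<open>h(t l(t)) = f(t)\<close> by Lagrange inversion. Hence
  \<open>f\<^sup>m = \<Sum>\<^sub>i [t\<^sup>i](h\<^sup>m) t\<^sup>i l\<^sup>i\<close>; multiply by \<open>g f\<^sup>k\<^sup>-\<^sup>m\<close> and compare the coefficients of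
  \<open>t\<^sup>n\<^sup>-\<^sup>k\<close>.
\<close>

section \<open>Formal power series\<close>

text \<open>Since \<open>b\<close> has zero constant term, \<open>b ^ i\<close> has no terms below
  degree \<open>i\<close>. The sum for each coefficient \<open>j\<close> of the composition can thus
  run to the common bound \<open>n\<close>, and the two sums can be swapped.\<close>

lemma fps_compose_mult_nth:
  fixes a b h :: "'a::comm_ring_1 fps"
  assumes "fps_nth b 0 = 0"
  shows "fps_nth (fps_compose a b * h) n = (\<Sum>i=0..n. fps_nth a i * fps_nth (b ^ i * h) n)"
proof -
  have comp: "fps_nth (fps_compose a b) j = (\<Sum>i=0..n. fps_nth a i * fps_nth (b ^ i) j)"
    if "j \<le> n" for j
    unfolding fps_compose_nth using that assms
    by (intro sum.mono_neutral_left) (auto simp: startsby_zero_power_prefix)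
  have "fps_nth (fps_compose a b * h) n =
      (\<Sum>j=0..n. \<Sum>i=0..n. fps_nth a i * (fps_nth (b ^ i) j * fps_nth h (n - j)))"
    by (simp add: fps_mult_nth comp sum_distrib_right mult.assoc)
  also have "\<dots> = (\<Sum>i=0..n. \<Sum>j=0..n. fps_nth a i * (fps_nth (b ^ i) j * fps_nth h (n - j)))"
    by (rule sum.swap)
  finally show ?thesis
    by (simp add: fps_mult_nth sum_distrib_left)
qed

text \<open>The residue of \<open>g\<^sup>-\<^sup>d\<^sup>-\<^sup>1 g'\<close> for \<open>g = t l\<close> and \<open>u = 1/l\<close>, written without Laurent series.\<close>

lemma fps_residue_power_deriv:
  fixes l u :: "'a::{idom,ring_char_0} fps"
  assumes "l * u = 1"
  shows "fps_nth (u ^ Suc d * fps_deriv (fps_X * l)) d = (if d = 0 then 1 else 0)"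
proof -
  have split: "u ^ Suc d * fps_deriv (fps_X * l) =
      u ^ d + fps_X * (fps_deriv l * u ^ Suc d)"
  proof -
    have "u ^ Suc d * fps_deriv (fps_X * l) =
        u ^ d * (l * u) + fps_X * (fps_deriv l * u ^ Suc d)"
      by (simp add: algebra_simps)
    then show ?thesis by (simp add: assms)
  qed
  show ?thesis
  proof (cases d)
    case 0
    then show ?thesis using split by simp
  next
    case (Suc e)
    \<comment> \<open>Differentiating \<open>l * u = 1\<close> and multiplying by \<open>u\<close>
      gives u' = - l' u^2.\<close>
    have "l * fps_deriv u + fps_deriv l * u = 0"
      using arg_cong[OF assms, of fps_deriv] by simp
    then have "u * (l * fps_deriv u + fps_deriv l * u) = 0" by simp
    then have "(l * u) * fps_deriv u = - (fps_deriv l * u ^ 2)"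
      by (simp add: algebra_simps power2_eq_square eq_neg_iff_add_eq_0)
    then have du: "fps_deriv u = - (fps_deriv l * u ^ 2)" by (simp add: assms)
    have "fps_deriv (u ^ d) = - (of_nat d * (fps_deriv l * u ^ Suc d))"
      unfolding fps_deriv_power' du Suc by (simp add: power2_eq_square algebra_simps)
    then have "fps_nth (fps_deriv (u ^ d)) e =
        - (of_nat d * fps_nth (fps_deriv l * u ^ Suc d) e)"
      by (simp add: fps_mult_of_nat_nth del: fps_deriv_nth)
    \<comment> \<open>With \<open>d = Suc e\<close>, coefficient \<open>e\<close> of the derivative
      of \<open>u ^ d\<close> is d times coefficient \<open>d\<close> of \<open>u ^ d\<close>;
      characteristic zero then allows cancelling d.\<close>
    then have "of_nat d * (fps_nth (u ^ d) d + fps_nth (fps_deriv l * u ^ Suc d) e) = 0"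
      by (simp add: Suc algebra_simps del: of_nat_Suc power_Suc)
    moreover have "(of_nat d :: 'a) \<noteq> 0" using Suc by (simp del: of_nat_Suc)
    ultimately have "fps_nth (u ^ d) d + fps_nth (fps_deriv l * u ^ Suc d) e = 0"
      by (simp only: mult_eq_0_iff) simp
    then show ?thesis
      unfolding split by (simp add: Suc del: power_Suc)
  qed
qed

text \<open>With g = t l, the chain rule turns the series on the left into (b' o g) u^(n+1) g'.
  Expanding b' o g in powers of g, the term g^i u^(n+1) g' equals t^i u^(n-i+1) g', and the residue
  computation keeps only i = n. What survives is coefficient n of b'.\<close>

lemma fps_lagrange_coeff:
  fixes b l u :: "'a::{idom,ring_char_0} fps"
  assumes "l * u = 1"
  shows "fps_nth (fps_deriv (fps_compose b (fps_X * l)) * u ^ Suc n) n =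
    of_nat (Suc n) * fps_nth b (Suc n)"
proof -
  let ?g = "fps_X * l"
  have residue: "fps_nth (?g ^ i * (u ^ Suc n * fps_deriv ?g)) n = (if i = n then 1 else 0)"
    if "i \<le> n" for i
  proof -
    have lu: "l ^ i * u ^ Suc n = u ^ Suc (n - i)"
    proof -
      have "Suc n = i + Suc (n - i)" using that by simp
      then have "l ^ i * u ^ Suc n = (l * u) ^ i * u ^ Suc (n - i)"
        by (metis power_add power_mult_distrib mult.assoc)
      then show ?thesis by (simp add: assms)
    qed
    have "?g ^ i * (u ^ Suc n * fps_deriv ?g) =
        fps_X ^ i * ((l ^ i * u ^ Suc n) * fps_deriv ?g)"
      by (simp only: power_mult_distrib mult.assoc)
    then have "fps_nth (?g ^ i * (u ^ Suc n * fps_deriv ?g)) n =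
        fps_nth (u ^ Suc (n - i) * fps_deriv ?g) (n - i)"
      unfolding lu using that by (simp only: fps_X_power_mult_nth) simp
    then show ?thesis
      using that fps_residue_power_deriv[OF assms, of "n - i"] by simp
  qed
  have "fps_deriv (fps_compose b ?g) * u ^ Suc n =
      fps_compose (fps_deriv b) ?g * (u ^ Suc n * fps_deriv ?g)"
    by (subst fps_compose_deriv) (simp_all add: ac_simps)
  then have "fps_nth (fps_deriv (fps_compose b ?g) * u ^ Suc n) n =
      fps_nth (fps_compose (fps_deriv b) ?g * (u ^ Suc n * fps_deriv ?g)) n"
    by (rule arg_cong)
  also have "\<dots> =
      (\<Sum>i=0..n. fps_nth (fps_deriv b) i * fps_nth (?g ^ i * (u ^ Suc n * fps_deriv ?g)) n)"
    by (rule fps_compose_mult_nth) simp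
  also have "\<dots> = (\<Sum>i=0..n. fps_nth (fps_deriv b) i * (if i = n then 1 else 0))"
    by (intro sum.cong refl) (simp only: residue atLeastAtMost_iff)
  finally show ?thesis by (simp add: mult_delta_right)
qed

text \<open>Were h' nonzero of subdegree n, coefficient n of h' u^(n+1) would be the leading
  coefficient of h' times a power of the constant term of u, which is nonzero. So these coefficients
  and the constant term determine a series.\<close>

lemma fps_eq_0_if_lagrange_coeffs_0:
  fixes h u :: "'a::{idom,ring_char_0} fps"
  assumes "fps_nth u 0 \<noteq> 0" "fps_nth h 0 = 0"
    and coeffs: "\<And>n. fps_nth (fps_deriv h * u ^ Suc n) n = 0"
  shows "h = 0"
proof -
  have "fps_deriv h = 0"
  proof (rule ccontr)
    assume nz: "fps_deriv h \<noteq> 0"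
    define n where "n = subdegree (fps_deriv h)"
    have "fps_nth (fps_deriv h * u ^ Suc n) n = fps_nth (fps_deriv h) n * fps_nth u 0 ^ Suc n"
      by (simp add: fps_mult_nth_conv_upto_subdegree_left n_def fps_power_zeroth
          del: fps_deriv_nth power_Suc)
    moreover have "fps_nth (fps_deriv h) n \<noteq> 0"
      unfolding n_def using nz by (rule nth_subdegree_nonzero)
    ultimately show False
      using coeffs[of n] assms(1) by simp
  qed
  then show ?thesis using assms(2) by simp
qed

text \<open>The candidate \<open>b\<close> is verified rather than solved for: its composition with
  t l and \<open>f\<close> have the same constant term and, by \<open>fps_lagrange_coeff\<close>,
  the same coefficients [t^n] of derivative times u^(n+1). Hence their difference vanishes.\<close>

theorem fps_lagrange_inversion:
  fixes b f l u :: "'a::{idom,ring_char_0} fps"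
  assumes "l * u = 1" and "fps_nth b 0 = fps_nth f 0"
    and "\<And>n. of_nat (Suc n) * fps_nth b (Suc n) = fps_nth (fps_deriv f * u ^ Suc n) n"
  shows "fps_compose b (fps_X * l) = f"
proof -
  have "fps_nth l 0 * fps_nth u 0 = 1"
    using arg_cong[OF assms(1), of "\<lambda>f. fps_nth f 0"] by simp
  then have "fps_nth u 0 \<noteq> 0" by auto
  then have "fps_compose b (fps_X * l) - f = 0"
    by (rule fps_eq_0_if_lagrange_coeffs_0)
      (simp_all only: fps_deriv_sub left_diff_distrib fps_sub_nth fps_lagrange_coeff[OF assms(1)]
        assms(2,3) fps_compose_nth_0 diff_self)
  then show ?thesis by simp
qed

section \<open>Integer powers of power series\<close>

text \<open>Writing an integer as a difference of naturals reduces the laws of integer powers to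
  those of natural powers, without a case split on signs in each of them.\<close>

lemma fps_int_power_diff:
  fixes f u :: "'a::comm_ring_1 fps"
  assumes "fps_nth f 0 = 1" "f * u = 1"
  shows "fps_int_power f (int a - int b) = f ^ a * u ^ b"
proof -
  have "f * fps_right_inverse f 1 = 1"
    using assms by (intro fps_right_inverse) simp
  \<comment> \<open>Inverses are unique in a commutative ring.\<close>
  then have u: "fps_right_inverse f 1 = u"
    using assms(2) by (metis mult.commute mult.left_commute mult_1_right)
  have fu: "f ^ j * u ^ j = 1" for j
    using assms(2) by (simp flip: power_mult_distrib)
  show ?thesis
  proof (cases "b \<le> a")
    case True
    then obtain d where "a = d + b" using le_Suc_ex by (metis add.commute)
    then show ?thesis by (simp add: fps_int_power_def power_add mult.assoc fu)
  next
    case False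
    then obtain d where "b = a + Suc d" using less_imp_Suc_add[of a b] by auto
    moreover from this have "fps_int_power f (int a - int b) = u ^ Suc d"
      by (simp add: fps_int_power_def u nat_add_distrib del: power_Suc)
    moreover have "f ^ a * u ^ (a + Suc d) = u ^ Suc d"
      by (simp only: power_add fu mult_1_left flip: mult.assoc)
    ultimately show ?thesis by simp
  qed
qed

lemma fps_int_power_of_nat: "fps_int_power f (int i) = f ^ i"
  by (simp add: fps_int_power_def)

lemma fps_int_power_minus_of_nat:
  fixes f u :: "'a::comm_ring_1 fps"
  assumes "fps_nth f 0 = 1" "f * u = 1"
  shows "fps_int_power f (- int b) = u ^ b"
  using fps_int_power_diff[OF assms, of 0 b] by simp

lemma fps_int_power_add:
  fixes f :: "'a::comm_ring_1 fps"
  assumes "fps_nth f 0 = 1"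
  shows "fps_int_power f (i + j) = fps_int_power f i * fps_int_power f j"
proof -
  obtain u where u: "f * u = 1"
    using fps_right_inverse[of f 1] assms by auto
  obtain a b c d where i: "i = int a - int b" and j: "j = int c - int d"
    by (metis int_diff_cases)
  have "i + j = int (a + c) - int (b + d)" by (simp add: i j)
  then show ?thesis
    unfolding i j by (simp only: fps_int_power_diff[OF assms u] power_add) (simp add: ac_simps)
qed

text \<open>Substituting a series without constant term is a ring homomorphism, so it maps the
  inverse of \<open>f\<close> to the inverse of the composition.\<close>

lemma fps_int_power_compose:
  fixes f g :: "'a::idom fps"
  assumes "fps_nth f 0 = 1" "fps_nth g 0 = 0"
  shows "fps_compose (fps_int_power f m) g = fps_int_power (fps_compose f g) m"
proof -
  obtain u where u: "f * u = 1"
    using fps_right_inverse[of f 1] assms by auto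
  have v: "fps_compose f g * fps_compose u g = 1"
    using assms(2) u by (simp flip: fps_compose_mult_distrib)
  obtain a b where m: "m = int a - int b"
    by (metis int_diff_cases)
  show ?thesis
    unfolding m fps_int_power_diff[OF assms(1) u]
    using assms by (subst fps_int_power_diff[OF _ v])
      (simp_all add: fps_compose_mult_distrib fps_compose_power)
qed

lemma smult_sum_right: "smult a (\<Sum>i\<in>S. f i) = (\<Sum>i\<in>S. smult a (f i))"
  by (induction S rule: infinite_finite_induct) (simp_all add: smult_add_right)

section \<open>Factorization of the evaluation\<close>

lemma poly_mapping_eq_sum_single:
  "p = (\<Sum>m\<in>Poly_Mapping.keys p. Poly_Mapping.single m (Poly_Mapping.lookup p m))"
  by (rule poly_mapping_eqI) (auto simp: lookup_sum lookup_single when_def in_keys_iff)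

lemma umbrae_of_umbra [simp]: "umbrae_of (umbra \<alpha>) = {\<alpha>}"
  by (simp add: umbrae_of_def umbra_def)

lemma umbrae_of_add: "umbrae_of (p + q) \<subseteq> umbrae_of p \<union> umbrae_of q"
  using keys_add[of p q] by (auto simp: umbrae_of_def)

lemma umbrae_of_mult: "umbrae_of (p * q) \<subseteq> umbrae_of p \<union> umbrae_of q"
  using keys_mult[of p q] keys_add by (fastforce simp: umbrae_of_def)

lemma umbrae_of_power: "umbrae_of (p ^ n) \<subseteq> umbrae_of p"
proof (induction n)
  case 0
  then show ?case by (simp add: umbrae_of_def)
next
  case (Suc n)
  then show ?case using umbrae_of_mult[of p "p ^ n"] by auto
qed

lemma finite_umbrae_of: "finite (umbrae_of p)"
  by (simp add: umbrae_of_def)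

context umbral_calculus
begin

lemma E_0: "E 0 = 0"
  using E_add[of 0 0] by simp

lemma E_sum: "E (\<Sum>x\<in>A. f x) = (\<Sum>x\<in>A. E (f x))"
  by (induction A rule: infinite_finite_induct) (simp_all add: E_0 E_add)

lemma E_base: "E (base r) = r"
  using E_base_mult[of r 1] by (simp add: E_one)

lemma E_of_nat_mult: "E (of_nat n * p) = of_nat n * E p"
  by (induction n) (simp_all add: E_0 E_add algebra_simps)

text \<open>Umbrae of \<open>S\<close> absent from \<open>m\<close> enter with exponent 0 and
  contribute E 1 = 1.\<close>

lemma E_single:
  assumes "finite S" "Poly_Mapping.keys m \<subseteq> S"
  shows "E (Poly_Mapping.single m r) = r * (\<Prod>\<alpha>\<in>S. E (umbra \<alpha> ^ Poly_Mapping.lookup m \<alpha>))"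
proof -
  have "m = (\<Sum>\<alpha>\<in>S. Poly_Mapping.single \<alpha> (Poly_Mapping.lookup m \<alpha>))"
    using assms
    by (intro poly_mapping_eqI) (auto simp: lookup_sum lookup_single when_def in_keys_iff)
  then have "Poly_Mapping.single m r =
      base r * (\<Prod>\<alpha>\<in>S. umbra \<alpha> ^ Poly_Mapping.lookup m \<alpha>)"
    using assms(1) by (simp add: prod_umbra_power base_def mult_single)
  then show ?thesis
    using assms(1) by (simp add: E_base_mult E_uncorrelated)
qed

text \<open>On each of the two disjoint supports the exponents of \<open>m + m'\<close> come from
  one monomial only, so the product of moments splits.\<close>

lemma E_single_mult:
  assumes "Poly_Mapping.keys m \<inter> Poly_Mapping.keys m' = {}"
  shows "E (Poly_Mapping.single m r * Poly_Mapping.single m' s) =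
    E (Poly_Mapping.single m r) * E (Poly_Mapping.single m' s)"
proof -
  let ?K = "Poly_Mapping.keys m" and ?K' = "Poly_Mapping.keys m'"
  have disj: "\<alpha> \<in> ?K \<Longrightarrow> Poly_Mapping.lookup m' \<alpha> = 0"
    "\<alpha> \<in> ?K' \<Longrightarrow> Poly_Mapping.lookup m \<alpha> = 0" for \<alpha>
    using assms by (meson disjoint_iff in_keys_iff)+
  have "E (Poly_Mapping.single (m + m') (r * s)) =
      r * s * (\<Prod>\<alpha>\<in>?K \<union> ?K'. E (umbra \<alpha> ^ Poly_Mapping.lookup (m + m') \<alpha>))"
    by (rule E_single) (simp_all add: keys_add)
  also have "(\<Prod>\<alpha>\<in>?K \<union> ?K'. E (umbra \<alpha> ^ Poly_Mapping.lookup (m + m') \<alpha>)) =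
      (\<Prod>\<alpha>\<in>?K. E (umbra \<alpha> ^ Poly_Mapping.lookup (m + m') \<alpha>)) *
      (\<Prod>\<alpha>\<in>?K'. E (umbra \<alpha> ^ Poly_Mapping.lookup (m + m') \<alpha>))"
    using assms by (intro prod.union_disjoint) auto
  also have "(\<Prod>\<alpha>\<in>?K. E (umbra \<alpha> ^ Poly_Mapping.lookup (m + m') \<alpha>)) =
      (\<Prod>\<alpha>\<in>?K. E (umbra \<alpha> ^ Poly_Mapping.lookup m \<alpha>))"
    by (intro prod.cong) (simp_all add: lookup_add disj)
  also have "(\<Prod>\<alpha>\<in>?K'. E (umbra \<alpha> ^ Poly_Mapping.lookup (m + m') \<alpha>)) =
      (\<Prod>\<alpha>\<in>?K'. E (umbra \<alpha> ^ Poly_Mapping.lookup m' \<alpha>))"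
    by (intro prod.cong) (simp_all add: lookup_add disj)
  finally show ?thesis
    by (simp add: mult_single E_single[OF finite_keys order.refl] ac_simps)
qed

text \<open>Bilinearity extends the factorization from monomials to polynomials without common
  umbrae. This is how uncorrelatedness enters all later computations.\<close>

lemma E_mult:
  assumes "umbrae_of p \<inter> umbrae_of q = {}"
  shows "E (p * q) = E p * E q"
proof -
  let ?p = "\<lambda>m. Poly_Mapping.single m (Poly_Mapping.lookup p m)"
  let ?q = "\<lambda>m. Poly_Mapping.single m (Poly_Mapping.lookup q m)"
  have "E (p * q) =
      E ((\<Sum>m\<in>Poly_Mapping.keys p. ?p m) * (\<Sum>m\<in>Poly_Mapping.keys q. ?q m))"
    by (simp flip: poly_mapping_eq_sum_single)
  also have "\<dots> = (\<Sum>m\<in>Poly_Mapping.keys p. \<Sum>m'\<in>Poly_Mapping.keys q. E (?p m * ?q m'))"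
    by (simp add: sum_product E_sum)
  also have "\<dots> = (\<Sum>m\<in>Poly_Mapping.keys p. \<Sum>m'\<in>Poly_Mapping.keys q. E (?p m) * E (?q m'))"
    using assms by (intro sum.cong refl E_single_mult) (auto simp: umbrae_of_def)
  also have "\<dots> = E (\<Sum>m\<in>Poly_Mapping.keys p. ?p m) * E (\<Sum>m\<in>Poly_Mapping.keys q. ?q m)"
    by (simp add: sum_product E_sum)
  finally show ?thesis
    by (simp flip: poly_mapping_eq_sum_single)
qed

lemma E_power_mult:
  assumes "umbrae_of p \<inter> umbrae_of q = {}"
  shows "E (p ^ i * q ^ j) = E (p ^ i) * E (q ^ j)"
  using assms umbrae_of_power[of p i] umbrae_of_power[of q j] by (intro E_mult) auto

section \<open>Generating functions of umbrae\<close>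

lemma E_power_eq_nth_gf: "E (p ^ n) = smult (fact n) (fps_nth (umbral_gf E p) n)"
  by (simp add: umbral_gf_def)

lemma smult_E_power: "smult (1 / fact n) (E (p ^ n)) = fps_nth (umbral_gf E p) n"
  by (simp add: umbral_gf_def)

lemma is_dot_iff_gf: "is_dot E m p \<beta> \<longleftrightarrow> umbral_gf E (umbra \<beta>) = fps_int_power (umbral_gf E p) m"
proof -
  have "r = smult (fact n) s \<longleftrightarrow> smult (1 / fact n) r = s" for r s :: "complex poly" and n
    by auto
  then show ?thesis
    by (simp add: is_dot_def fps_eq_iff smult_E_power)
qed

lemma nth_deriv_gf: "fps_nth (fps_deriv (umbral_gf E p)) n = smult (1 / fact n) (E (p ^ Suc n))"
proof -
  have "fps_nth (fps_deriv (umbral_gf E p)) n =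
      smult (of_nat (Suc n) * (1 / fact (Suc n))) (E (p ^ Suc n))"
    by (simp add: umbral_gf_def of_nat_mult_conv_smult del: of_nat_Suc fact_Suc power_Suc)
  also have "of_nat (Suc n) * (1 / fact (Suc n)) = (1 / fact n :: complex)"
    by (simp del: of_nat_Suc)
  finally show ?thesis .
qed

text \<open>Binomial theorem, with the binomial coefficient over n! split as 1/(i! (n-i)!). The case
  r = 0 makes generating functions multiplicative; r = 1 yields the moments occurring in
  \<open>is_K\<close>.\<close>

lemma smult_E_mult_add_power:
  assumes "umbrae_of p \<inter> umbrae_of q = {}"
  shows "smult (1 / fact n) (E (p ^ r * (p + q) ^ n)) =
    (\<Sum>i=0..n. smult (1 / fact i) (E (p ^ (r + i))) * fps_nth (umbral_gf E q) (n - i))"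
proof -
  have "E (p ^ r * (p + q) ^ n) =
      (\<Sum>i=0..n. of_nat (n choose i) * (E (p ^ (r + i)) * E (q ^ (n - i))))"
    by (simp add: binomial_ring sum_distrib_left E_sum mult.left_commute[of _ "of_nat _"]
        mult.assoc E_of_nat_mult E_power_mult[OF assms] atMost_atLeast0
        flip: power_add mult.assoc[of "p ^ r" "p ^ _"])
  also have "smult (1 / fact n) \<dots> = (\<Sum>i=0..n. smult (1 / fact n * of_nat (n choose i))
      (E (p ^ (r + i)) * E (q ^ (n - i))))"
    by (simp add: smult_sum_right of_nat_mult_conv_smult)
  also have "\<dots> = (\<Sum>i=0..n. smult (1 / fact i * (1 / fact (n - i)))
      (E (p ^ (r + i)) * E (q ^ (n - i))))"
    by (intro sum.cong refl) (simp add: binomial_fact)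
  finally show ?thesis
    by (simp add: umbral_gf_def mult.commute)
qed

lemma umbral_gf_add:
  assumes "umbrae_of p \<inter> umbrae_of q = {}"
  shows "umbral_gf E (p + q) = umbral_gf E p * umbral_gf E q"
proof (rule fps_ext)
  fix n
  show "fps_nth (umbral_gf E (p + q)) n = fps_nth (umbral_gf E p * umbral_gf E q) n"
    using smult_E_mult_add_power[OF assms, of n 0] by (simp add: fps_mult_nth smult_E_power)
qed

lemma smult_E_mult_power:
  assumes "umbrae_of p \<inter> umbrae_of q = {}"
  shows "smult (1 / fact n) (E (p * (p + q) ^ n)) =
    fps_nth (fps_deriv (umbral_gf E p) * umbral_gf E q) n"
  using smult_E_mult_add_power[OF assms, of n 1]
  by (simp add: fps_mult_nth nth_deriv_gf del: fps_deriv_nth)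

section \<open>Generating functions of \<KK> and of \<omega>-Riordan arrays\<close>

text \<open>Divided by n!, the moment condition of index n+1 in \<open>is_K\<close> becomes exactly
  the coefficient hypothesis of Lagrange inversion, with \<open>u\<close> the reciprocal of the
  generating function of \<alpha>.\<close>

lemma umbral_gf_K:
  assumes "is_K E \<sigma> \<alpha> \<kappa>"
  shows "fps_compose (umbral_gf E (umbra \<kappa>)) (fps_X * umbral_gf E (umbra \<alpha>)) =
    umbral_gf E (umbra \<sigma>)"
proof -
  let ?l = "umbral_gf E (umbra \<alpha>)"
  obtain u where u: "?l * u = 1"
    using fps_right_inverse[of ?l 1] umbral_gf_nth_0 by auto
  show ?thesis
  proof (rule fps_lagrange_inversion[OF u])
    show "fps_nth (umbral_gf E (umbra \<kappa>)) 0 = fps_nth (umbral_gf E (umbra \<sigma>)) 0"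
      by (simp add: umbral_gf_nth_0)
  next
    fix n
    \<comment> \<open>The moment of index n+1 involves the dot product with -(n+1) but only the n-th
      power of the sum.\<close>
    define \<beta> where "\<beta> = dot_avoiding E {\<sigma>} (- int (Suc n)) (umbra \<alpha>)"
    have "\<beta> \<noteq> \<sigma>" and "is_dot E (- int (Suc n)) (umbra \<alpha>) \<beta>"
      using dot_avoiding[of "{\<sigma>}"] by (auto simp: \<beta>_def)
    then have gf: "umbral_gf E (umbra \<beta>) = u ^ Suc n"
      unfolding is_dot_iff_gf fps_int_power_minus_of_nat[OF umbral_gf_nth_0 u] by simp
    have K: "E (umbra \<kappa> ^ Suc n) = E (umbra \<sigma> * (umbra \<sigma> + umbra \<beta>) ^ n)"
      using assms by (auto simp: is_K_def umbral_eq_def \<beta>_def)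
    have "of_nat (Suc n) * fps_nth (umbral_gf E (umbra \<kappa>)) (Suc n) =
        smult (1 / fact n) (E (umbra \<kappa> ^ Suc n))"
      using nth_deriv_gf[of "umbra \<kappa>" n] by simp
    also have "\<dots> = fps_nth (fps_deriv (umbral_gf E (umbra \<sigma>)) * umbral_gf E (umbra \<beta>)) n"
      unfolding K using \<open>\<beta> \<noteq> \<sigma>\<close> by (intro smult_E_mult_power) simp
    finally show "of_nat (Suc n) * fps_nth (umbral_gf E (umbra \<kappa>)) (Suc n) =
        fps_nth (fps_deriv (umbral_gf E (umbra \<sigma>)) * u ^ Suc n) n"
      by (simp only: gf)
  qed
qed

text \<open>The auxiliary umbra avoids those of \<open>p\<close>, so generating functions multiply
  and the choice of representative disappears from the result.\<close>

lemma omega_riordan_eq_gf: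
  assumes "k \<le> n"
  shows "omega_riordan E c p q n k =
    smult (c n / c k) (fps_nth (umbral_gf E p * umbral_gf E q ^ k) (n - k))"
proof -
  define \<beta> where "\<beta> = dot_avoiding E (umbrae_of p) (int k) q"
  have "\<beta> \<notin> umbrae_of p" and "is_dot E (int k) q \<beta>"
    using dot_avoiding[OF finite_umbrae_of] by (auto simp: \<beta>_def)
  then have "umbral_gf E (p + umbra \<beta>) = umbral_gf E p * umbral_gf E q ^ k"
    by (subst umbral_gf_add) (auto simp: is_dot_iff_gf fps_int_power_of_nat)
  then show ?thesis
    using assms
    by (simp add: omega_riordan_def E_base_mult E_power_eq_nth_gf flip: \<beta>_def)
qed

text \<open>Split f^k as f^m f^(k-m), for f the generating function of \<alpha>, and replace f^m by
  the m-th power of that of \<kappa>, composed with t l. The arbitrary factor \<open>h\<close> will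
  be the generating function of \<gamma>.\<close>

lemma nth_gf_K_expansion:
  assumes "is_K E \<alpha> lam \<kappa>"
  shows "fps_nth (h * umbral_gf E (umbra \<alpha>) ^ k) N =
    (\<Sum>i=0..N. fps_nth (fps_int_power (umbral_gf E (umbra \<kappa>)) m) i *
      fps_nth (h * fps_int_power (umbral_gf E (umbra \<alpha>)) (int k - m) *
        umbral_gf E (umbra lam) ^ i) (N - i))"
proof -
  let ?f = "umbral_gf E (umbra \<alpha>)" and ?l = "umbral_gf E (umbra lam)"
  let ?b = "fps_int_power (umbral_gf E (umbra \<kappa>)) m"
  let ?h = "h * fps_int_power ?f (int k - m)"
  have "fps_int_power ?f m = fps_compose ?b (fps_X * ?l)"
    by (simp add: fps_int_power_compose umbral_gf_nth_0 umbral_gf_K[OF assms])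
  moreover have "?f ^ k = fps_int_power ?f m * fps_int_power ?f (int k - m)"
    by (simp add: umbral_gf_nth_0 fps_int_power_of_nat flip: fps_int_power_add)
  ultimately have "h * ?f ^ k = fps_compose ?b (fps_X * ?l) * ?h"
    by (simp add: ac_simps)
  then have "fps_nth (h * ?f ^ k) N = fps_nth (fps_compose ?b (fps_X * ?l) * ?h) N"
    by (rule arg_cong)
  also have "\<dots> = (\<Sum>i=0..N. fps_nth ?b i * fps_nth ((fps_X * ?l) ^ i * ?h) N)"
    by (rule fps_compose_mult_nth) simp
  also have "\<dots> = (\<Sum>i=0..N. fps_nth ?b i * fps_nth (?h * ?l ^ i) (N - i))"
  proof (intro sum.cong refl)
    fix i assume "i \<in> {0..N}"
    moreover have "(fps_X * ?l) ^ i * ?h = fps_X ^ i * (?h * ?l ^ i)"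
      by (simp only: power_mult_distrib ac_simps)
    ultimately show "fps_nth ?b i * fps_nth ((fps_X * ?l) ^ i * ?h) N =
        fps_nth ?b i * fps_nth (?h * ?l ^ i) (N - i)"
      by (simp only: fps_X_power_mult_nth) simp
  qed
  finally show ?thesis .
qed

end

text \<open>Auxiliary umbrae are arbitrary representatives, and uncorrelatedness is expressed by
  distinctness within each summand; the representative of i.\<lambda> may vary with i.\<close>

theorem theorem3p11:
  fixes E :: "'u umbral_poly \<Rightarrow> complex poly"
    and c :: "nat \<Rightarrow> complex"
    and \<omega> \<gamma> \<alpha> lam \<kappa> \<mu> \<delta> :: 'u
    and \<nu> :: "nat \<Rightarrow> 'u"
    and m :: int and n k :: nat
  assumes "umbral_calculus E"
    and "\<And>j. c j \<noteq> 0" and "c 0 = 1"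
    and "\<And>j. umbral_eq E (umbra \<omega> ^ j) (scalar (fact j / c j))"
    and "k \<le> n"
    and "is_K E \<alpha> lam \<kappa>"
    and "is_dot E m (umbra \<kappa>) \<mu>"
    and "is_dot E (int k - m) (umbra \<alpha>) \<delta>"
    and "\<And>i. i \<le> n - k \<Longrightarrow> is_dot E (int i) (umbra lam) (\<nu> i)"
    and "\<And>i. i \<le> n - k \<Longrightarrow> distinct [\<mu>, \<gamma>, \<delta>, \<nu> i]"
  shows "umbral_eq E
           (base (omega_riordan E c (umbra \<gamma>) (umbra \<alpha>) n k))
           (scalar (c n / c k) *
             (\<Sum>i=0..n-k. (scalar (1 / fact i) * umbra \<mu> ^ i) *
               (scalar (1 / fact (n - k - i)) *
                 (umbra \<gamma> + umbra \<delta> + umbra (\<nu> i)) ^ (n - k - i))))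
       \<and> umbral_eq E
           (base (omega_riordan E c (umbra \<gamma>) (umbra \<alpha>) n k))
           (scalar (c n / (c k * c (n - k))) *
             (\<Sum>i=0..n-k. scalar (c i) * (scalar (1 / fact i) * umbra \<mu> ^ i) *
               base (omega_riordan E c (umbra \<gamma> + umbra \<delta>) (umbra lam) (n - k) i)))"
proof -
  interpret umbral_calculus E by fact
  note K = \<open>is_K E \<alpha> lam \<kappa>\<close> and kn = \<open>k \<le> n\<close> and c0 = assms(2)
  let ?N = "n - k" and ?h = "umbral_gf E (umbra \<gamma>)"
  let ?b = "fps_int_power (umbral_gf E (umbra \<kappa>)) m"
  let ?fd = "fps_int_power (umbral_gf E (umbra \<alpha>)) (int k - m)"
  let ?l = "umbral_gf E (umbra lam)"
  \<comment> \<open>The index 0 always lies in the summation range.\<close>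
  have distinct: "\<gamma> \<noteq> \<delta>" "\<mu> \<noteq> \<gamma>" "\<mu> \<noteq> \<delta>"
    using assms(10)[of 0] by auto
  have \<mu>: "smult (1 / fact i) (E (umbra \<mu> ^ i)) = fps_nth ?b i" for i
    using \<open>is_dot E m (umbra \<kappa>) \<mu>\<close> by (simp add: smult_E_power is_dot_iff_gf)
  have \<gamma>\<delta>: "umbral_gf E (umbra \<gamma> + umbra \<delta>) = ?h * ?fd"
    using \<open>is_dot E (int k - m) (umbra \<alpha>) \<delta>\<close> distinct
    by (simp add: umbral_gf_add is_dot_iff_gf)
  \<comment> \<open>Common value of both right-hand sides, which are matched with it summand by
    summand.\<close>
  have lhs: "omega_riordan E c (umbra \<gamma>) (umbra \<alpha>) n k = smult (c n / c k)
      (\<Sum>i=0..?N. fps_nth ?b i * fps_nth (?h * ?fd * ?l ^ i) (?N - i))"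
    using nth_gf_K_expansion[OF K, of ?h k ?N m] kn by (simp add: omega_riordan_eq_gf)
  have summand1: "E (scalar (1 / fact i) * umbra \<mu> ^ i *
        (scalar (1 / fact (?N - i)) * (umbra \<gamma> + umbra \<delta> + umbra (\<nu> i)) ^ (?N - i))) =
      fps_nth ?b i * fps_nth (?h * ?fd * ?l ^ i) (?N - i)" if "i \<in> {0..?N}" for i
  proof -
    let ?p = "umbra \<gamma> + umbra \<delta> + umbra (\<nu> i)"
    have i: "is_dot E (int i) (umbra lam) (\<nu> i)" "\<nu> i \<noteq> \<gamma>" "\<nu> i \<noteq> \<delta>" "\<mu> \<noteq> \<nu> i"
      using that assms(9)[of i] assms(10)[of i] by auto
    have sub: "umbrae_of (umbra \<gamma> + umbra \<delta>) \<subseteq> {\<gamma>, \<delta>}"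
      using umbrae_of_add[of "umbra \<gamma>" "umbra \<delta>"] by auto
    then have "umbral_gf E ?p = ?h * ?fd * ?l ^ i"
      using i by (subst umbral_gf_add) (auto simp: \<gamma>\<delta> is_dot_iff_gf fps_int_power_of_nat)
    then have p: "smult (1 / fact (?N - i)) (E (?p ^ (?N - i))) =
        fps_nth (?h * ?fd * ?l ^ i) (?N - i)"
      by (simp add: smult_E_power)
    \<comment> \<open>As \<mu> is none of the umbrae of the sum, E splits the summand into a
      coefficient of \<open>?b\<close> and a coefficient of a product of generating
      functions.\<close>
    have "umbrae_of (umbra \<mu>) \<inter> umbrae_of ?p = {}"
      using sub umbrae_of_add[of "umbra \<gamma> + umbra \<delta>" "umbra (\<nu> i)"] i distinct by auto
    then have "E (umbra \<mu> ^ i * ?p ^ (?N - i)) = E (umbra \<mu> ^ i) * E (?p ^ (?N - i))"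
      by (rule E_power_mult)
    moreover have comm: "scalar (1 / fact i) * umbra \<mu> ^ i * (scalar (1 / fact (?N - i)) * ?p ^ (?N - i)) =
        scalar (1 / fact i) * (scalar (1 / fact (?N - i)) * (umbra \<mu> ^ i * ?p ^ (?N - i)))"
      by (simp only: ac_simps)
    ultimately show ?thesis
      unfolding comm by (simp only: E_base_mult flip: \<mu> p) simp
  qed
  \<comment> \<open>The array entry already lies in the base ring, so it leaves E as a scalar. Its
    factor \<open>c ?N / c i\<close> cancels \<open>c i\<close>; the remaining \<open>c ?N\<close>
    cancels against the outer denominator at the end.\<close>
  have summand2: "E (scalar (c i) * (scalar (1 / fact i) * umbra \<mu> ^ i) *
        base (omega_riordan E c (umbra \<gamma> + umbra \<delta>) (umbra lam) ?N i)) =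
      smult (c ?N) (fps_nth ?b i * fps_nth (?h * ?fd * ?l ^ i) (?N - i))" if "i \<in> {0..?N}" for i
  proof -
    let ?r = "omega_riordan E c (umbra \<gamma> + umbra \<delta>) (umbra lam) ?N i"
    have r: "?r = smult (c ?N / c i) (fps_nth (?h * ?fd * ?l ^ i) (?N - i))"
      using that by (simp add: omega_riordan_eq_gf \<gamma>\<delta>)
    have comm: "scalar (c i) * (scalar (1 / fact i) * umbra \<mu> ^ i) * base ?r =
        base ?r * (scalar (c i) * (scalar (1 / fact i) * umbra \<mu> ^ i))"
      by (simp only: ac_simps)
    have "E (scalar (c i) * (scalar (1 / fact i) * umbra \<mu> ^ i) * base ?r) =
        ?r * smult (c i) (fps_nth ?b i)"
      unfolding comm by (simp only: E_base_mult flip: \<mu>) simp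
    then show ?thesis
      unfolding r using c0[of i] by (simp add: mult.commute)
  qed
  show ?thesis
    unfolding umbral_eq_def E_base E_base_mult E_sum lhs
  proof (intro conjI)
    show "smult (c n / c k) (\<Sum>i=0..?N. fps_nth ?b i * fps_nth (?h * ?fd * ?l ^ i) (?N - i)) =
      [:c n / c k:] * (\<Sum>i=0..?N. E (scalar (1 / fact i) * umbra \<mu> ^ i *
        (scalar (1 / fact (?N - i)) * (umbra \<gamma> + umbra \<delta> + umbra (\<nu> i)) ^ (?N - i))))"
      by (subst sum.cong[OF refl summand1]) simp_all
    show "smult (c n / c k) (\<Sum>i=0..?N. fps_nth ?b i * fps_nth (?h * ?fd * ?l ^ i) (?N - i)) =
      [:c n / (c k * c ?N):] * (\<Sum>i=0..?N. E (scalar (c i) * (scalar (1 / fact i) * umbra \<mu> ^ i) *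
        base (omega_riordan E c (umbra \<gamma> + umbra \<delta>) (umbra lam) ?N i)))"
      using c0[of ?N] by (subst sum.cong[OF refl summand2]) (simp_all flip: smult_sum_right)
  qed
qed

end
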